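(* Let $(I,\tilde g,V,\lambda,\mu)$ be an almost $\eta$-Ricci soliton with $\eta=dx^3$ and $V=\sum_{k=1}^3V^kE_k$. Suppose that $f_1=f_1(x^2)$ depends only on $x^2$, $f_2=f_2(x^3)$ depends only on $x^3$, and $V^1,V^2,V^3$ depend only on $x^3$. Put $a=f_2\frac{f_1'}{f_1}$ and $d=\frac{f_2'}{f_2}$. Then there are $c_1,c_2,c_3\in\mathbb R$ and a smooth real function $F=F(x^2)$ on $I_2$ such that $$V^1=c_1,\quad V^2=c_2f_2+\frac{c_3}{f_2},\quad aV^1=0,\quad dV^3=aV^2+d'-d^2,\quad a=-c_2f_2+F,$$ $$\lambda=aV^2-f_2F'+a^2,\qquad (V^3)'=-(d'-d^2)-(\lambda+\mu).$$ Moreover: (i) if $f_2$ is constant, then $V^2$ is constant; (ii) if $f_2$ is not constant, then $f_1(x^2)=c_4e^{-c_2x^2}$ for some $c_4\in\mathbb R\setminus\{0\}$, and $a=-c_2f_2$; (iii) if $V^1\neq0$, then $a=0$, $dV^3=d'-d^2$, $\lambda=-f_2F'$, and $f_1$ is constant. If, in addition, $f_2$ is not constant, then $V^2=\frac{c_3}{f_2}$, $F=0$, $\lambda=0$, and $\mu=-(V^3)'-(d'-d^2)$.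
   Context: Let $I=I_1\times I_2\times I_3\subseteq\mathbb R^3$ with $I_1,I_2,I_3\subseteq\mathbb R$ open intervals and standard coordinates $x^1,x^2,x^3$. Let $f_1,f_2$ be smooth nowhere zero functions on $I$ and endow $I$ with the Riemannian metric $\tilde g=\frac{1}{f_1^2}dx^1\otimes dx^1+\frac{1}{f_2^2}dx^2\otimes dx^2+dx^3\otimes dx^3$. Let $E_1=f_1\frac{\partial}{\partial x^1}$, $E_2=f_2\frac{\partial}{\partial x^2}$, $E_3=\frac{\partial}{\partial x^3}$ (an orthonormal frame). For a smooth vector field $V$, a $1$-form $\eta$, and smooth functions $\lambda,\mu$ on $I$ with $\mu\neq0$ (not identically zero), $(I,\tilde g,V,\lambda,\mu)$ is an almost $\eta$-Ricci soliton if $\frac12\pounds_V\tilde g+\mathrm{Ric}+\lambda\tilde g+\mu\,\eta\otimes\eta=0$ on $I$, where $\pounds_V\tilde g$ is the Lie derivative of $\tilde g$ along $V$ and $\mathrm{Ric}$ is the Ricci tensor of $\tilde g$, with $\mathrm{Ric}(Y,Z)=\sum_{k}\tilde g(R(E_k,Y)Z,E_k)$, $R(X,Y)Z=\nabla_X\nabla_YZ-\nabla_Y\nabla_XZ-\nabla_{[X,Y]}Z$, $\nabla$ the Levi-Civita connection. A prime denotes the derivative of a function of a single variable with respect to that variable. *)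

theory Defs
  imports "HOL-Analysis.Analysis"
begin

text \<open>
  Tensor fields on an open set \<open>S\<close> of \<open>real ^ 'n\<close> are total functions of which only the values
  on \<open>S\<close> matter: vector fields have type \<open>real ^ 'n \<Rightarrow> real ^ 'n\<close>, and 1-forms and metrics
  assign to each point a (bi)linear form on \<open>real ^ 'n\<close>. Every notion below is meant for open \<open>S\<close>.
\<close>

primrec Ck_on :: "nat \<Rightarrow> 'a::real_normed_vector set \<Rightarrow> ('a \<Rightarrow> 'b::real_normed_vector) \<Rightarrow> bool" where
  "Ck_on 0 S f \<longleftrightarrow> continuous_on S f"
| "Ck_on (Suc k) S f \<longleftrightarrow>
     (\<forall>x\<in>S. f differentiable (at x)) \<and> (\<forall>v. Ck_on k S (\<lambda>x. frechet_derivative f (at x) v))"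

definition smooth_on :: "'a::real_normed_vector set \<Rightarrow> ('a \<Rightarrow> 'b::real_normed_vector) \<Rightarrow> bool" where
  "smooth_on S f \<longleftrightarrow> (\<forall>k. Ck_on k S f)"

type_synonym 'n vfield = "real ^ 'n \<Rightarrow> real ^ 'n"
type_synonym 'n form1 = "real ^ 'n \<Rightarrow> real ^ 'n \<Rightarrow> real"
type_synonym 'n metric = "real ^ 'n \<Rightarrow> real ^ 'n \<Rightarrow> real ^ 'n \<Rightarrow> real"
type_synonym 'n connection = "'n vfield \<Rightarrow> 'n vfield \<Rightarrow> 'n vfield"

definition dir_deriv :: "'n::finite vfield \<Rightarrow> (real ^ 'n \<Rightarrow> real) \<Rightarrow> real ^ 'n \<Rightarrow> real" where
  "dir_deriv X f p = frechet_derivative f (at p) (X p)"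

definition lie_bracket :: "'n::finite vfield \<Rightarrow> 'n vfield \<Rightarrow> 'n vfield" where
  "lie_bracket X Y p = frechet_derivative Y (at p) (X p) - frechet_derivative X (at p) (Y p)"

definition riemannian_metric_on :: "(real ^ 'n::finite) set \<Rightarrow> 'n metric \<Rightarrow> bool" where
  "riemannian_metric_on S g \<longleftrightarrow>
     (\<forall>p\<in>S. bilinear (g p) \<and> (\<forall>v w. g p v w = g p w v) \<and> (\<forall>v. v \<noteq> 0 \<longrightarrow> g p v v > 0)) \<and>
     (\<forall>v w. smooth_on S (\<lambda>p. g p v w))"

definition smooth_form1_on :: "(real ^ 'n::finite) set \<Rightarrow> 'n form1 \<Rightarrow> bool" where
  "smooth_form1_on S \<eta> \<longleftrightarrow> (\<forall>p\<in>S. linear (\<eta> p)) \<and> (\<forall>v. smooth_on S (\<lambda>p. \<eta> p v))"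

definition affine_connection_on :: "(real ^ 'n::finite) set \<Rightarrow> 'n connection \<Rightarrow> bool" where
  "affine_connection_on S nabla \<longleftrightarrow>
     (\<forall>X Y. smooth_on S X \<longrightarrow> smooth_on S Y \<longrightarrow> smooth_on S (nabla X Y)) \<and>
     (\<forall>X X' Y. smooth_on S X \<longrightarrow> smooth_on S X' \<longrightarrow> smooth_on S Y \<longrightarrow>
        (\<forall>p\<in>S. nabla (\<lambda>q. X q + X' q) Y p = nabla X Y p + nabla X' Y p)) \<and>
     (\<forall>f X Y. smooth_on S f \<longrightarrow> smooth_on S X \<longrightarrow> smooth_on S Y \<longrightarrow>
        (\<forall>p\<in>S. nabla (\<lambda>q. f q *\<^sub>R X q) Y p = f p *\<^sub>R nabla X Y p)) \<and>
     (\<forall>X Y Y'. smooth_on S X \<longrightarrow> smooth_on S Y \<longrightarrow> smooth_on S Y' \<longrightarrow>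
        (\<forall>p\<in>S. nabla X (\<lambda>q. Y q + Y' q) p = nabla X Y p + nabla X Y' p)) \<and>
     (\<forall>f X Y. smooth_on S f \<longrightarrow> smooth_on S X \<longrightarrow> smooth_on S Y \<longrightarrow>
        (\<forall>p\<in>S. nabla X (\<lambda>q. f q *\<^sub>R Y q) p = f p *\<^sub>R nabla X Y p + dir_deriv X f p *\<^sub>R Y p))"

definition levi_civita_on :: "(real ^ 'n::finite) set \<Rightarrow> 'n metric \<Rightarrow> 'n connection \<Rightarrow> bool" where
  "levi_civita_on S g nabla \<longleftrightarrow>
     affine_connection_on S nabla \<and>
     (\<forall>X Y. smooth_on S X \<longrightarrow> smooth_on S Y \<longrightarrow>
        (\<forall>p\<in>S. nabla X Y p - nabla Y X p = lie_bracket X Y p)) \<and>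
     (\<forall>X Y Z. smooth_on S X \<longrightarrow> smooth_on S Y \<longrightarrow> smooth_on S Z \<longrightarrow>
        (\<forall>p\<in>S. dir_deriv X (\<lambda>q. g q (Y q) (Z q)) p
                  = g p (nabla X Y p) (Z p) + g p (Y p) (nabla X Z p)))"

definition curvature :: "'n::finite connection \<Rightarrow> 'n vfield \<Rightarrow> 'n vfield \<Rightarrow> 'n vfield \<Rightarrow> 'n vfield" where
  "curvature nabla X Y Z p =
     nabla X (nabla Y Z) p - nabla Y (nabla X Z) p - nabla (lie_bracket X Y) Z p"

definition orthonormal_frame_on :: "(real ^ 'n::finite) set \<Rightarrow> 'n metric \<Rightarrow> ('n \<Rightarrow> 'n vfield) \<Rightarrow> bool" where
  "orthonormal_frame_on S g E \<longleftrightarrow>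
     (\<forall>i. smooth_on S (E i)) \<and>
     (\<forall>p\<in>S. \<forall>i j. g p (E i p) (E j p) = (if i = j then 1 else 0))"

text \<open>
  The Ricci tensor as a trace of the curvature over the frame \<open>E\<close>, which is meant to be orthonormal.
\<close>
definition ricci ::
  "'n::finite metric \<Rightarrow> 'n connection \<Rightarrow> ('n \<Rightarrow> 'n vfield) \<Rightarrow> 'n vfield \<Rightarrow> 'n vfield \<Rightarrow> real ^ 'n \<Rightarrow> real" where
  "ricci g nabla E Y Z p = (\<Sum>k\<in>UNIV. g p (curvature nabla (E k) Y Z p) (E k p))"

definition lie_deriv_metric ::
  "'n::finite vfield \<Rightarrow> 'n metric \<Rightarrow> 'n vfield \<Rightarrow> 'n vfield \<Rightarrow> real ^ 'n \<Rightarrow> real" where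
  "lie_deriv_metric V g X Y p =
     dir_deriv V (\<lambda>q. g q (X q) (Y q)) p
       - g p (lie_bracket V X p) (Y p) - g p (X p) (lie_bracket V Y p)"

text \<open>
  The connection \<open>nabla\<close> and the frame \<open>E\<close> enter only through the Ricci tensor, which does not
  depend on the choice of \<open>E\<close>. The function \<open>mu\<close> may vanish at some points, but not identically.
\<close>
definition almost_eta_ricci_soliton_on ::
  "(real ^ 'n::finite) set \<Rightarrow> 'n metric \<Rightarrow> 'n connection \<Rightarrow> ('n \<Rightarrow> 'n vfield) \<Rightarrow>
   'n vfield \<Rightarrow> 'n form1 \<Rightarrow> (real ^ 'n \<Rightarrow> real) \<Rightarrow> (real ^ 'n \<Rightarrow> real) \<Rightarrow> bool" where
  "almost_eta_ricci_soliton_on S g nabla E V \<eta> lam mu \<longleftrightarrow>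
     riemannian_metric_on S g \<and> levi_civita_on S g nabla \<and> orthonormal_frame_on S g E \<and>
     smooth_on S V \<and> smooth_form1_on S \<eta> \<and> smooth_on S lam \<and> smooth_on S mu \<and>
     (\<exists>p\<in>S. mu p \<noteq> 0) \<and>
     (\<forall>X Y. smooth_on S X \<longrightarrow> smooth_on S Y \<longrightarrow>
        (\<forall>p\<in>S. 1 / 2 * lie_deriv_metric V g X Y p + ricci g nabla E X Y p
                  + lam p * g p (X p) (Y p) + mu p * (\<eta> p (X p) * \<eta> p (Y p)) = 0))"

definition box3 :: "real set \<Rightarrow> real set \<Rightarrow> real set \<Rightarrow> (real ^ 3) set" where
  "box3 I1 I2 I3 = {p. p $ 1 \<in> I1 \<and> p $ 2 \<in> I2 \<and> p $ 3 \<in> I3}"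

definition gtilde :: "(real ^ 3 \<Rightarrow> real) \<Rightarrow> (real ^ 3 \<Rightarrow> real) \<Rightarrow> 3 metric" where
  "gtilde f1 f2 p v w =
     1 / (f1 p)\<^sup>2 * (v $ 1 * w $ 1) + 1 / (f2 p)\<^sup>2 * (v $ 2 * w $ 2) + v $ 3 * w $ 3"

definition frame :: "(real ^ 3 \<Rightarrow> real) \<Rightarrow> (real ^ 3 \<Rightarrow> real) \<Rightarrow> 3 \<Rightarrow> 3 vfield" where
  "frame f1 f2 k p =
     (if k = 1 then f1 p *\<^sub>R axis 1 1 else if k = 2 then f2 p *\<^sub>R axis 2 1 else axis 3 1)"

definition dx :: "'n::finite \<Rightarrow> 'n form1" where
  "dx i p v = v $ i"

end

theory Submission
  imports Defs
begin

text \<open>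
  In the orthonormal frame the only nonzero connection coefficients
  \<open>conn i j k = g(nabla E\<^sub>i E\<^sub>j, E\<^sub>k)\<close> are \<open>conn 1 1 2 = a = - conn 1 2 1\<close> and
  \<open>conn 2 2 3 = d = - conn 2 3 2\<close>, so the soliton equation becomes six scalar equations. With
  \<open>h = f1'/f1\<close>, its (2,3) component reads \<open>(V2 f2)' = - 2 h f2 f2'\<close>, where \<open>h\<close> depends on
  \<open>x\<^sup>2\<close> and everything else on \<open>x\<^sup>3\<close>. If \<open>f2\<close> is constant, then so is \<open>V2\<close>, and one takes
  \<open>c2 = 0\<close>, \<open>F = f2 h\<close>; otherwise \<open>h\<close> is a constant \<open>- c2\<close>, integration gives \<open>V2\<close> and \<open>f1\<close>,
  and \<open>F = 0\<close>.
\<close>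

section \<open>Smooth functions\<close>

text \<open>\<open>frechet_derivative\<close> is a choice among all derivatives at the point, so it
  suffices that two functions agreeing near \<open>x\<close> have the same derivatives there.
  Differentiability does not enter.\<close>

lemma frechet_derivative_cong_open:
  assumes "open S" "x \<in> S" "\<And>y. y \<in> S \<Longrightarrow> f y = g y"
  shows "frechet_derivative f (at x) = frechet_derivative g (at x)"
proof -
  have "(f has_derivative D) (at x) \<longleftrightarrow> (g has_derivative D) (at x)" for D
    using assms has_derivative_transform_within_open[of _ D x UNIV S] by (metis (no_types, lifting))
  then show ?thesis
    by (simp add: frechet_derivative_def)
qed

lemma Ck_on_cong:
  assumes "open S" "\<And>x. x \<in> S \<Longrightarrow> f x = g x" "Ck_on k S f"
  shows "Ck_on k S g"
  using assms(2,3)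
proof (induction k arbitrary: f g)
  case 0
  then show ?case
    using continuous_on_cong by fastforce
next
  case (Suc k)
  have "g differentiable at x" if "x \<in> S" for x
    using Suc.prems that assms(1) has_derivative_transform_within_open[of f _ x UNIV S g]
    unfolding Ck_on.simps differentiable_def by blast
  moreover have "Ck_on k S (\<lambda>x. frechet_derivative g (at x) v)" for v
  proof (rule Suc.IH)
    show "Ck_on k S (\<lambda>x. frechet_derivative f (at x) v)"
      using Suc.prems by simp
    show "frechet_derivative f (at x) v = frechet_derivative g (at x) v" if "x \<in> S" for x
      using frechet_derivative_cong_open[OF assms(1) that Suc.prems(1)] by simp
  qed
  ultimately show ?case by simp
qed

text \<open>Allows an explicit derivative \<open>D\<close> that is known on \<open>S\<close> only:
  by openness it may replace \<open>frechet_derivative\<close> in the recursion. The inductive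
  closure proofs below use this form.\<close>

lemma Ck_on_SucI:
  assumes "open S" "\<And>x. x \<in> S \<Longrightarrow> (f has_derivative D x) (at x)" "\<And>v. Ck_on k S (\<lambda>x. D x v)"
  shows "Ck_on (Suc k) S f"
proof -
  have "Ck_on k S (\<lambda>x. frechet_derivative f (at x) v)" for v
    by (rule Ck_on_cong[OF assms(1) _ assms(3)]) (simp add: frechet_derivative_at[OF assms(2), symmetric])
  then show ?thesis
    using assms(2) by (auto simp: differentiable_def)
qed

lemma Ck_on_Suc_has_derivative:
  assumes "Ck_on (Suc k) S f" "x \<in> S"
  shows "(f has_derivative frechet_derivative f (at x)) (at x)"
  using assms by (simp add: frechet_derivative_works)

lemma Ck_on_SucD: "Ck_on (Suc k) S f \<Longrightarrow> Ck_on k S f"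
proof (induction k arbitrary: f)
  case 0
  then show ?case
    by (simp add: continuous_at_imp_continuous_on differentiable_imp_continuous_within)
qed (metis Ck_on.simps(2))

section \<open>Closure of smooth functions under algebraic operations, affine substitution and
  differentiation\<close>

lemma Ck_on_const: "Ck_on k S (\<lambda>_. c)"
  by (induction k arbitrary: c) (simp_all add: frechet_derivative_const)

lemma Ck_on_add:
  assumes "open S" "Ck_on k S f" "Ck_on k S g"
  shows "Ck_on k S (\<lambda>x. f x + g x)"
  using assms(2,3)
proof (induction k arbitrary: f g)
  case (Suc k)
  show ?case
  proof (rule Ck_on_SucI[OF assms(1)])
    show "((\<lambda>x. f x + g x) has_derivative
        (\<lambda>v. frechet_derivative f (at x) v + frechet_derivative g (at x) v)) (at x)" if "x \<in> S" for x
      using Suc.prems that by (intro has_derivative_add Ck_on_Suc_has_derivative)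
  qed (use Suc in auto)
qed (simp add: continuous_on_add)

lemma Ck_on_bounded_linear:
  assumes "open S" "bounded_linear L" "Ck_on k S f"
  shows "Ck_on k S (\<lambda>x. L (f x))"
  using assms(3)
proof (induction k arbitrary: f)
  case 0
  then show ?case
    using assms(2) by (simp add: bounded_linear.continuous_on)
next
  case (Suc k)
  show ?case
  proof (rule Ck_on_SucI[OF assms(1)])
    show "((\<lambda>x. L (f x)) has_derivative (\<lambda>v. L (frechet_derivative f (at x) v))) (at x)" if "x \<in> S" for x
      using Suc.prems that
      by (intro bounded_linear.has_derivative[OF assms(2)] Ck_on_Suc_has_derivative)
  qed (use Suc in auto)
qed

text \<open>An affine map has the constant derivative \<open>L\<close>, so differentiating the
  composite in direction \<open>v\<close> gives a derivative of \<open>f\<close> in the fixed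
  direction \<open>L v\<close>, composed with the same map. The induction therefore closes without
  products. The lemma serves to restrict functions to coordinate lines.\<close>

lemma Ck_on_compose_affine:
  assumes "open T" "bounded_linear L" "\<And>x. x \<in> T \<Longrightarrow> b + L x \<in> S" "Ck_on k S f"
  shows "Ck_on k T (\<lambda>x. f (b + L x))"
  using assms(4)
proof (induction k arbitrary: f)
  case 0
  have "continuous_on T (\<lambda>x. b + L x)"
    by (intro continuous_intros bounded_linear.continuous_on[OF assms(2)])
  with 0 show ?case
    using assms(3) by (auto intro!: continuous_on_compose2[of S f])
next
  case (Suc k)
  show ?case
  proof (rule Ck_on_SucI[OF assms(1)])
    fix x assume x: "x \<in> T"
    have "((\<lambda>x. b + L x) has_derivative L) (at x)"
      using has_derivative_add[OF has_derivative_const bounded_linear_imp_has_derivative[OF assms(2)]]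
      by simp
    then show "((\<lambda>x. f (b + L x)) has_derivative (\<lambda>v. frechet_derivative f (at (b + L x)) (L v))) (at x)"
      by (rule has_derivative_compose) (use Ck_on_Suc_has_derivative[OF Suc.prems] assms(3) x in auto)
  next
    show "Ck_on k T (\<lambda>x. frechet_derivative f (at (b + L x)) (L v))" for v
      using Suc.prems by (intro Suc.IH) simp
  qed
qed

lemma Ck_on_mult:
  fixes f g :: "'a::real_normed_vector \<Rightarrow> 'b::real_normed_algebra"
  assumes "open S" "Ck_on k S f" "Ck_on k S g"
  shows "Ck_on k S (\<lambda>x. f x * g x)"
  using assms(2,3)
proof (induction k arbitrary: f g)
  case (Suc k)
  show ?case
  proof (rule Ck_on_SucI[OF assms(1)])
    show "((\<lambda>x. f x * g x) has_derivative
        (\<lambda>v. f x * frechet_derivative g (at x) v + frechet_derivative f (at x) v * g x)) (at x)"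
      if "x \<in> S" for x
      using Suc.prems that by (intro has_derivative_mult Ck_on_Suc_has_derivative)
    show "Ck_on k S (\<lambda>x. f x * frechet_derivative g (at x) v + frechet_derivative f (at x) v * g x)" for v
      \<comment> \<open>The Leibniz rule also contains the undifferentiated factors, which have to
        be lowered from order \<open>Suc k\<close> to order \<open>k\<close>.\<close>
      using Suc.prems Suc.prems[THEN Ck_on_SucD] by (intro Ck_on_add[OF assms(1)] Suc.IH) auto
  qed
qed (simp add: continuous_on_mult)

text \<open>The derivative of \<open>1/f\<close> is a product of \<open>1/f\<close>,
  \<open>f'\<close> and \<open>1/f\<close>; the induction hypothesis makes the factors
  \<open>1/f\<close> of class \<open>k\<close>, and the product rule does the rest.\<close>

lemma Ck_on_inverse:
  fixes f :: "'a::real_normed_vector \<Rightarrow> 'b::real_normed_field"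
  assumes "open S" "Ck_on k S f" "\<And>x. x \<in> S \<Longrightarrow> f x \<noteq> 0"
  shows "Ck_on k S (\<lambda>x. inverse (f x))"
  using assms(2)
proof (induction k)
  case 0
  then show ?case
    using assms(3) by (simp add: continuous_on_inverse)
next
  case (Suc k)
  have inv: "Ck_on k S (\<lambda>x. inverse (f x))"
    using Suc Ck_on_SucD by blast
  show ?case
  proof (rule Ck_on_SucI[OF assms(1)])
    show "((\<lambda>x. inverse (f x)) has_derivative
        (\<lambda>h. - (inverse (f x) * frechet_derivative f (at x) h * inverse (f x)))) (at x)"
      if "x \<in> S" for x
      by (rule Deriv.has_derivative_inverse[OF assms(3)[OF that] Ck_on_Suc_has_derivative[OF Suc.prems that]])
    show "Ck_on k S (\<lambda>x. - (inverse (f x) * frechet_derivative f (at x) v * inverse (f x)))" for v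
      using Suc.prems inv
      by (auto intro!: Ck_on_bounded_linear[OF assms(1) bounded_linear_minus[OF bounded_linear_ident]]
          Ck_on_mult assms(1))
  qed
qed

lemma smooth_on_cong:
  "open S \<Longrightarrow> (\<And>x. x \<in> S \<Longrightarrow> f x = g x) \<Longrightarrow> smooth_on S f \<Longrightarrow> smooth_on S g"
  unfolding smooth_on_def using Ck_on_cong by blast

lemma smooth_on_const: "smooth_on S (\<lambda>_. c)"
  by (simp add: smooth_on_def Ck_on_const)

lemma smooth_on_add: "open S \<Longrightarrow> smooth_on S f \<Longrightarrow> smooth_on S g \<Longrightarrow> smooth_on S (\<lambda>x. f x + g x)"
  by (simp add: smooth_on_def Ck_on_add)

lemma smooth_on_bounded_linear:
  "open S \<Longrightarrow> bounded_linear L \<Longrightarrow> smooth_on S f \<Longrightarrow> smooth_on S (\<lambda>x. L (f x))"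
  by (simp add: smooth_on_def Ck_on_bounded_linear)

lemma smooth_on_diff: "open S \<Longrightarrow> smooth_on S f \<Longrightarrow> smooth_on S g \<Longrightarrow> smooth_on S (\<lambda>x. f x - g x)"
  using smooth_on_add[of S f "\<lambda>x. - g x"]
    smooth_on_bounded_linear[OF _ bounded_linear_minus[OF bounded_linear_ident], of S g] by simp

lemma smooth_on_compose_affine:
  "open T \<Longrightarrow> bounded_linear L \<Longrightarrow> (\<And>x. x \<in> T \<Longrightarrow> b + L x \<in> S) \<Longrightarrow> smooth_on S f
    \<Longrightarrow> smooth_on T (\<lambda>x. f (b + L x))"
  unfolding smooth_on_def using Ck_on_compose_affine by blast

lemma smooth_on_mult:
  fixes f g :: "'a::real_normed_vector \<Rightarrow> 'b::real_normed_algebra"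
  shows "open S \<Longrightarrow> smooth_on S f \<Longrightarrow> smooth_on S g \<Longrightarrow> smooth_on S (\<lambda>x. f x * g x)"
  by (simp add: smooth_on_def Ck_on_mult)

lemma smooth_on_divide:
  fixes f g :: "'a::real_normed_vector \<Rightarrow> 'b::real_normed_field"
  shows "open S \<Longrightarrow> smooth_on S f \<Longrightarrow> smooth_on S g \<Longrightarrow> (\<And>x. x \<in> S \<Longrightarrow> g x \<noteq> 0)
    \<Longrightarrow> smooth_on S (\<lambda>x. f x / g x)"
  using smooth_on_mult[of S f "\<lambda>x. inverse (g x)"]
  by (simp add: smooth_on_def Ck_on_inverse divide_inverse)

lemma smooth_on_differentiable: "smooth_on S f \<Longrightarrow> x \<in> S \<Longrightarrow> f differentiable at x"
  unfolding smooth_on_def by (metis Ck_on.simps(2))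

lemma smooth_on_DERIV:
  fixes f :: "real \<Rightarrow> real"
  shows "smooth_on S f \<Longrightarrow> x \<in> S \<Longrightarrow> (f has_field_derivative deriv f x) (at x)"
  by (simp add: DERIV_deriv_iff_real_differentiable smooth_on_differentiable)

text \<open>On the real line \<open>deriv f\<close> is the directional derivative along the vector
  1, which is one of the functions in the recursion of \<open>Ck_on\<close>.\<close>

lemma smooth_on_deriv:
  fixes f :: "real \<Rightarrow> real"
  assumes "open S" "smooth_on S f"
  shows "smooth_on S (deriv f)"
proof -
  have "smooth_on S (\<lambda>x. frechet_derivative f (at x) 1)"
    unfolding smooth_on_def
  proof
    show "Ck_on k S (\<lambda>x. frechet_derivative f (at x) 1)" for k
      using assms(2)[unfolded smooth_on_def, rule_format, of "Suc k"] by simp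
  qed
  moreover have "frechet_derivative f (at x) 1 = deriv f x" if "x \<in> S" for x
    using smooth_on_DERIV[OF assms(2) that]
    by (simp add: has_field_derivative_def frechet_derivative_at[symmetric])
  ultimately show ?thesis
    by (rule smooth_on_cong[OF assms(1), rotated])
qed

section \<open>Levi-Civita connection in an orthonormal frame\<close>

lemma dir_deriv_cong_open:
  assumes "open S" "p \<in> S" "\<And>q. q \<in> S \<Longrightarrow> f q = h q"
  shows "dir_deriv X f p = dir_deriv X h p"
  using frechet_derivative_cong_open[OF assms, of "\<lambda>q. q"] by (simp add: dir_deriv_def)

lemma dir_deriv_locally_const:
  assumes "open S" "p \<in> S" "\<And>q. q \<in> S \<Longrightarrow> f q = c"
  shows "dir_deriv X f p = 0"
  using dir_deriv_cong_open[of S p f "\<lambda>_. c", OF assms]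
  by (simp add: dir_deriv_def frechet_derivative_const)

section \<open>Pointwise dependence of a connection on its first argument\<close>

lemma affine_connection_on_add:
  "affine_connection_on S nabla \<Longrightarrow> smooth_on S X \<Longrightarrow> smooth_on S X' \<Longrightarrow> smooth_on S Y \<Longrightarrow> p \<in> S \<Longrightarrow>
    nabla (\<lambda>q. X q + X' q) Y p = nabla X Y p + nabla X' Y p"
  by (simp add: affine_connection_on_def)

lemma affine_connection_on_scaleR:
  "affine_connection_on S nabla \<Longrightarrow> smooth_on S f \<Longrightarrow> smooth_on S X \<Longrightarrow> smooth_on S Y \<Longrightarrow> p \<in> S \<Longrightarrow>
    nabla (\<lambda>q. f q *\<^sub>R X q) Y p = f p *\<^sub>R nabla X Y p"
  by (simp add: affine_connection_on_def)

text \<open>Smoothness of the partial sums is carried through the induction because additivity of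
  the connection is available for smooth fields only.\<close>

lemma affine_connection_on_sum:
  assumes "open S" "affine_connection_on S nabla" "finite A"
    "\<And>i. i \<in> A \<Longrightarrow> smooth_on S (X i)" "smooth_on S Y" "p \<in> S"
  shows "nabla (\<lambda>q. \<Sum>i\<in>A. X i q) Y p = (\<Sum>i\<in>A. nabla (X i) Y p)
    \<and> smooth_on S (\<lambda>q. \<Sum>i\<in>A. X i q)"
  using assms(3,4)
proof (induction A)
  case empty
  show ?case
    \<comment> \<open>The empty sum is the zero field, read as 0 times the zero field, so
      homogeneity over functions gives the value 0.\<close>
    using affine_connection_on_scaleR[OF assms(2) smooth_on_const smooth_on_const assms(5,6), of 0 0]
    by (simp add: smooth_on_const)
next
  case (insert i A)
  then show ?case
    using affine_connection_on_add[OF assms(2) _ _ assms(5,6), of "X i" "\<lambda>q. \<Sum>i\<in>A. X i q"]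
    by (simp add: smooth_on_add[OF assms(1)])
qed

lemma smooth_on_nth: "open S \<Longrightarrow> smooth_on S X \<Longrightarrow> smooth_on S (\<lambda>q. X q $ i)"
  by (rule smooth_on_bounded_linear[OF _ bounded_linear_vec_nth])

text \<open>Expanding \<open>X\<close> in the constant coordinate fields \<open>axis i 1\<close>, which are global, shows that
  \<open>nabla X Y\<close> at \<open>p\<close> depends on \<open>X\<close> only through \<open>X p\<close>.\<close>

lemma affine_connection_on_coordinates:
  assumes "open S" "affine_connection_on S nabla" "smooth_on S X" "smooth_on S Y" "p \<in> S"
  shows "nabla X Y p = (\<Sum>i\<in>UNIV. (X p $ i) *\<^sub>R nabla (\<lambda>_. axis i 1) Y p)"
proof -
  have comp: "nabla (\<lambda>q. (X q $ i) *\<^sub>R axis i 1) Y p = (X p $ i) *\<^sub>R nabla (\<lambda>_. axis i 1) Y p" for i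
    by (rule affine_connection_on_scaleR[OF assms(2) smooth_on_nth[OF assms(1,3)] smooth_on_const assms(4,5)])
  have smooth: "smooth_on S (\<lambda>q. (X q $ i) *\<^sub>R axis i (1::real))" for i
    by (rule smooth_on_bounded_linear[OF assms(1) bounded_linear_scaleR_left smooth_on_nth[OF assms(1,3)]])
  have "X = (\<lambda>q. \<Sum>i\<in>UNIV. (X q $ i) *\<^sub>R axis i 1)"
    using basis_expansion[of "X _"] by (simp add: scalar_mult_eq_scaleR)
  then have "nabla X Y p = nabla (\<lambda>q. \<Sum>i\<in>UNIV. (X q $ i) *\<^sub>R axis i 1) Y p"
    by simp
  also have "\<dots> = (\<Sum>i\<in>UNIV. nabla (\<lambda>q. (X q $ i) *\<^sub>R axis i 1) Y p)"
    using affine_connection_on_sum[OF assms(1,2) finite_class.finite_UNIV smooth assms(4,5)] by (rule conjunct1)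
  finally show ?thesis
    by (simp add: comp)
qed

section \<open>Connection, curvature and Lie derivative in terms of frame coefficients\<close>

locale orthonormal_frame_levi_civita =
  fixes S :: "(real ^ 'n::finite) set" and g :: "'n metric" and nabla :: "'n connection"
    and E :: "'n \<Rightarrow> 'n vfield"
  assumes open_S: "open S"
    and metric: "riemannian_metric_on S g"
    and levi_civita: "levi_civita_on S g nabla"
    and orthonormal: "orthonormal_frame_on S g E"
begin

text \<open>The Ricci rotation coefficients. Since the frame is orthonormal,
  \<open>conn i j k\<close> is also the coefficient of \<open>E k\<close> in the covariant
  derivative of \<open>E j\<close> along \<open>E i\<close>.\<close>

definition conn :: "'n \<Rightarrow> 'n \<Rightarrow> 'n \<Rightarrow> real ^ 'n \<Rightarrow> real" where
  "conn i j k p = g p (nabla (E i) (E j) p) (E k p)"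

lemma affine: "affine_connection_on S nabla"
  using levi_civita by (simp add: levi_civita_on_def)

lemma linear_left: "p \<in> S \<Longrightarrow> linear (\<lambda>v. g p v w)"
  using metric by (simp add: riemannian_metric_on_def bilinear_def)

lemma metric_sym: "p \<in> S \<Longrightarrow> g p v w = g p w v"
  using metric by (simp add: riemannian_metric_on_def)

lemma frame_smooth: "smooth_on S (E i)"
  using orthonormal by (simp add: orthonormal_frame_on_def)

lemma frame_orthonormal: "p \<in> S \<Longrightarrow> g p (E i p) (E j p) = (if i = j then 1 else 0)"
  using orthonormal by (simp add: orthonormal_frame_on_def)

lemma nabla_smooth: "smooth_on S X \<Longrightarrow> smooth_on S Y \<Longrightarrow> smooth_on S (nabla X Y)"
  using affine by (simp add: affine_connection_on_def)

lemma torsion_free: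
  "smooth_on S X \<Longrightarrow> smooth_on S Y \<Longrightarrow> p \<in> S \<Longrightarrow> lie_bracket X Y p = nabla X Y p - nabla Y X p"
  using levi_civita by (simp add: levi_civita_on_def)

lemma compatible:
  "smooth_on S X \<Longrightarrow> smooth_on S Y \<Longrightarrow> smooth_on S Z \<Longrightarrow> p \<in> S \<Longrightarrow>
    dir_deriv X (\<lambda>q. g q (Y q) (Z q)) p = g p (nabla X Y p) (Z p) + g p (Y p) (nabla X Z p)"
  using levi_civita by (simp add: levi_civita_on_def)

lemma lie_bracket_smooth:
  assumes "smooth_on S X" "smooth_on S Y"
  shows "smooth_on S (lie_bracket X Y)"
  using smooth_on_diff[OF open_S nabla_smooth[OF assms] nabla_smooth[OF assms(2,1)]]
  by (rule smooth_on_cong[OF open_S, rotated]) (simp add: torsion_free assms)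

lemma metric_diff_left: "p \<in> S \<Longrightarrow> g p (v - v') w = g p v w - g p v' w"
  using linear_diff[OF linear_left] by blast

lemma metric_sum_left:
  "p \<in> S \<Longrightarrow> g p (\<Sum>m\<in>A. c m *\<^sub>R v m) w = (\<Sum>m\<in>A. c m * g p (v m) w)"
  using linear_sum[OF linear_left, of p "\<lambda>m. c m *\<^sub>R v m" A w] linear_cmul[OF linear_left, of p _ _ w]
  by simp

text \<open>The map \<open>T\<close> taking scalar products with the frame sends the combination
  with coefficients \<open>y\<close> back to \<open>y\<close>. It is thus surjective, hence
  injective by equality of dimensions, and both sides have the same image under
  \<open>T\<close>.\<close>

lemma frame_expansion:
  assumes "p \<in> S"
  shows "v = (\<Sum>m\<in>UNIV. g p v (E m p) *\<^sub>R E m p)"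
proof -
  define T where "T = (\<lambda>x. \<chi> i. g p x (E i p))"
  have lin: "linear T"
    by (rule linearI)
      (simp_all add: T_def vec_eq_iff linear_add[OF linear_left[OF assms]] linear_cmul[OF linear_left[OF assms]])
  have T_sum: "T (\<Sum>m\<in>UNIV. c m *\<^sub>R E m p) = (\<chi> i. c i)" for c
    by (simp add: T_def vec_eq_iff metric_sum_left[OF assms] frame_orthonormal[OF assms] if_distrib cong: if_cong)
  have "y = T (\<Sum>m\<in>UNIV. (y $ m) *\<^sub>R E m p)" for y
    by (simp add: T_sum)
  then have "surj T"
    by (rule surjI[OF HOL.sym])
  then have "inj T"
    using linear_surjective_imp_injective[OF lin] by simp
  moreover have "T v = T (\<Sum>m\<in>UNIV. g p v (E m p) *\<^sub>R E m p)"
    unfolding T_sum by (simp add: T_def)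
  ultimately show ?thesis
    by (simp add: inj_eq)
qed

lemma parseval:
  assumes "p \<in> S"
  shows "g p v w = (\<Sum>m\<in>UNIV. g p v (E m p) * g p w (E m p))"
  by (subst frame_expansion[OF assms, of v])
    (simp only: metric_sum_left[OF assms] metric_sym[OF assms, of "E _ p" w])

text \<open>Scalar products of frame fields are constant, so metric compatibility makes the two
  terms of their derivative cancel.\<close>

lemma conn_antisym:
  assumes "p \<in> S"
  shows "conn i j k p = - conn i k j p"
proof -
  have "dir_deriv (E i) (\<lambda>q. g q (E j q) (E k q)) p = 0"
    by (rule dir_deriv_locally_const[OF open_S assms]) (simp add: frame_orthonormal)
  then show ?thesis
    using compatible[OF frame_smooth frame_smooth frame_smooth assms, of i j k]
      metric_sym[OF assms, of "E j p" "nabla (E i) (E k) p"]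
    by (simp add: conn_def)
qed

text \<open>Koszul's formula without derivative terms, as these vanish in an orthonormal frame.
  Torsion-freeness turns the brackets into six coefficients; by antisymmetry four of them cancel in
  pairs and the other two add up to twice \<open>conn i j k\<close>.\<close>

lemma conn_koszul:
  assumes "p \<in> S"
  defines "c \<equiv> \<lambda>i j k. g p (lie_bracket (E i) (E j) p) (E k p)"
  shows "conn i j k p = (c i j k - c j k i + c k i j) / 2"
proof -
  have "c i j k = conn i j k p - conn j i k p" for i j k
    by (simp add: c_def torsion_free[OF frame_smooth frame_smooth assms(1)] metric_diff_left assms(1) conn_def)
  then show ?thesis
    using conn_antisym[OF assms(1), of i j k] conn_antisym[OF assms(1), of j k i]
      conn_antisym[OF assms(1), of k i j] by simp
qed

text \<open>Both \<open>X\<close> and every \<open>E m\<close> are expanded in coordinate fields at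
  \<open>p\<close>. The frame expansion is then needed only for the single vector
  \<open>X p\<close>, and the claim is an exchange of two finite sums.\<close>

lemma nabla_frame_expansion:
  assumes "p \<in> S" "smooth_on S X" "smooth_on S Y"
  shows "nabla X Y p = (\<Sum>m\<in>UNIV. g p (X p) (E m p) *\<^sub>R nabla (E m) Y p)"
proof -
  have "nabla X Y p = (\<Sum>i\<in>UNIV. (\<Sum>m\<in>UNIV. g p (X p) (E m p) * (E m p $ i)) *\<^sub>R nabla (\<lambda>_. axis i 1) Y p)"
    unfolding affine_connection_on_coordinates[OF open_S affine assms(2,3,1)]
    by (subst frame_expansion[OF assms(1), of "X p"]) (simp add: sum_component)
  also have "\<dots> = (\<Sum>m\<in>UNIV. g p (X p) (E m p) *\<^sub>R (\<Sum>i\<in>UNIV. (E m p $ i) *\<^sub>R nabla (\<lambda>_. axis i 1) Y p))"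
    unfolding scaleR_sum_left scaleR_sum_right by (subst sum.swap) (simp add: mult.assoc)
  also have "\<dots> = (\<Sum>m\<in>UNIV. g p (X p) (E m p) *\<^sub>R nabla (E m) Y p)"
    by (simp add: affine_connection_on_coordinates[OF open_S affine frame_smooth assms(3,1)])
  finally show ?thesis .
qed

lemma curvature_frame:
  assumes p: "p \<in> S"
  shows "g p (curvature nabla (E k) (E i) (E j) p) (E l p) =
    dir_deriv (E k) (conn i j l) p - (\<Sum>m\<in>UNIV. conn i j m p * conn k l m p)
    - dir_deriv (E i) (conn k j l) p + (\<Sum>m\<in>UNIV. conn k j m p * conn i l m p)
    - (\<Sum>m\<in>UNIV. (conn k i m p - conn i k m p) * conn m j l p)"
proof -
  \<comment> \<open>Compatibility moves the outer derivative onto the scalar function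
    \<open>conn i j l\<close>; the remaining product of two covariant derivatives is expanded by
    Parseval's identity.\<close>
  have second: "g p (nabla (E k) (nabla (E i) (E j)) p) (E l p) =
      dir_deriv (E k) (conn i j l) p - (\<Sum>m\<in>UNIV. conn i j m p * conn k l m p)" for i j k l
    using compatible[OF frame_smooth nabla_smooth[OF frame_smooth frame_smooth] frame_smooth p, of k i j l]
      parseval[OF p, of "nabla (E i) (E j) p" "nabla (E k) (E l) p"]
    by (simp add: conn_def[abs_def])
  have "g p (lie_bracket (E k) (E i) p) (E m p) = conn k i m p - conn i k m p" for m
    by (simp add: torsion_free[OF frame_smooth frame_smooth p] metric_diff_left[OF p] conn_def)
  then have "g p (nabla (lie_bracket (E k) (E i)) (E j) p) (E l p) =
      (\<Sum>m\<in>UNIV. (conn k i m p - conn i k m p) * conn m j l p)"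
    using nabla_frame_expansion[OF p lie_bracket_smooth[OF frame_smooth frame_smooth] frame_smooth]
    by (simp add: metric_sum_left[OF p] conn_def)
  then show ?thesis
    by (simp add: curvature_def metric_diff_left[OF p] second)
qed

lemma lie_deriv_metric_frame:
  assumes p: "p \<in> S" and X: "smooth_on S X"
  shows "lie_deriv_metric X g (E i) (E j) p =
    dir_deriv (E i) (\<lambda>q. g q (X q) (E j q)) p + dir_deriv (E j) (\<lambda>q. g q (X q) (E i q)) p
    - (\<Sum>m\<in>UNIV. g p (X p) (E m p) * (conn i j m p + conn j i m p))"
proof -
  have nabla: "g p (nabla (E i) X p) (E j p) =
      dir_deriv (E i) (\<lambda>q. g q (X q) (E j q)) p - (\<Sum>m\<in>UNIV. g p (X p) (E m p) * conn i j m p)" for i j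
    using compatible[OF frame_smooth X frame_smooth p, of i j] parseval[OF p, of "X p" "nabla (E i) (E j) p"]
    by (simp add: conn_def)
  \<comment> \<open>Compatibility and torsion-freeness cancel the covariant derivatives along
    \<open>X\<close>, leaving the symmetrized covariant derivative of \<open>X\<close>.\<close>
  have "lie_deriv_metric X g (E i) (E j) p = g p (nabla (E i) X p) (E j p) + g p (nabla (E j) X p) (E i p)"
    unfolding lie_deriv_metric_def compatible[OF X frame_smooth frame_smooth p]
      torsion_free[OF X frame_smooth p] metric_diff_left[OF p]
      metric_sym[OF p, of "E i p" "nabla X (E j) p - nabla (E j) X p"] metric_sym[OF p, of "E i p" "nabla X (E j) p"]
    by simp
  then show ?thesis
    by (simp add: nabla distrib_left sum.distrib)
qed

end

section \<open>The frame of the metric \<open>gtilde\<close>\<close>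

lemma open_box3: "open I1 \<Longrightarrow> open I2 \<Longrightarrow> open I3 \<Longrightarrow> open (box3 I1 I2 I3)"
  using open_Int[OF open_Int[OF open_vimage_vec_nth[of I1 1] open_vimage_vec_nth[of I2 2]]
      open_vimage_vec_nth[of I3 3]]
  by (simp add: box3_def vimage_def Collect_conj_eq Int_assoc)

text \<open>The point in the last assumption is \<open>p\<close> with its coordinate
  \<open>k\<close> replaced by \<open>t\<close>, so \<open>f\<close> is the given function
  restricted to a coordinate line.\<close>

lemma smooth_on_slice:
  fixes f :: "real \<Rightarrow> real"
  assumes "open T" "smooth_on S (\<lambda>p :: real ^ 'n::finite. f (p $ k))"
    and "\<And>t. t \<in> T \<Longrightarrow> p - (p $ k) *\<^sub>R axis k 1 + t *\<^sub>R axis k 1 \<in> S"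
  shows "smooth_on T f"
  using smooth_on_compose_affine[OF assms(1) bounded_linear_scaleR_left assms(3,2)]
  by simp

lemma smooth_on_box3_slice:
  fixes f :: "real \<Rightarrow> real"
  assumes "open I2" "open I3" "p \<in> box3 I1 I2 I3"
  shows "smooth_on (box3 I1 I2 I3) (\<lambda>p. f (p $ 2)) \<Longrightarrow> smooth_on I2 f"
    and "smooth_on (box3 I1 I2 I3) (\<lambda>p. f (p $ 3)) \<Longrightarrow> smooth_on I3 f"
  using assms
  by (auto intro!: smooth_on_slice[of _ "box3 I1 I2 I3" f _ p] simp: box3_def axis_def)

lemma dir_deriv_has_derivative: "(f has_derivative D) (at p) \<Longrightarrow> dir_deriv X f p = D (X p)"
  by (simp add: dir_deriv_def frechet_derivative_at[symmetric])

lemma has_derivative_component: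
  assumes "(f has_field_derivative D) (at (p $ k))"
  shows "((\<lambda>q :: real ^ 'n::finite. f (q $ k)) has_derivative (\<lambda>v. D * v $ k)) (at p)"
  using has_derivative_compose[OF bounded_linear_imp_has_derivative[OF bounded_linear_vec_nth[of k]]
      assms[unfolded has_field_derivative_def]] .

text \<open>The geometric objects are parameters with defining equations, so that the locale can be
  interpreted with the variables of the theorem. The function \<open>h\<close> is the factor of
  \<open>a\<close> that depends on the second coordinate.\<close>

locale gtilde_levi_civita =
  fixes I1 I2 I3 :: "real set" and f1 f2 :: "real \<Rightarrow> real" and nabla :: "3 connection"
    and I :: "(real ^ 3) set" and g :: "3 metric" and E :: "3 \<Rightarrow> 3 vfield"
    and h d :: "real \<Rightarrow> real" and a :: "real ^ 3 \<Rightarrow> real"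
  defines "I \<equiv> box3 I1 I2 I3"
    and "g \<equiv> gtilde (\<lambda>p. f1 (p $ 2)) (\<lambda>p. f2 (p $ 3))"
    and "E \<equiv> frame (\<lambda>p. f1 (p $ 2)) (\<lambda>p. f2 (p $ 3))"
    and "h \<equiv> \<lambda>y. deriv f1 y / f1 y"
    and "d \<equiv> \<lambda>t. deriv f2 t / f2 t"
    and "a \<equiv> \<lambda>p. f2 (p $ 3) * h (p $ 2)"
  assumes open_intervals: "open I1" "open I2" "open I3"
    and f1_smooth: "smooth_on I2 f1" and f1_nz: "\<And>y. y \<in> I2 \<Longrightarrow> f1 y \<noteq> 0"
    and f2_smooth: "smooth_on I3 f2" and f2_nz: "\<And>t. t \<in> I3 \<Longrightarrow> f2 t \<noteq> 0"
    and metric: "riemannian_metric_on I g"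
    and levi_civita: "levi_civita_on I g nabla"
    and orthonormal: "orthonormal_frame_on I g E"

sublocale gtilde_levi_civita \<subseteq> orthonormal_frame_levi_civita I g nabla E
  using open_intervals metric levi_civita orthonormal
  by unfold_locales (simp_all add: open_box3 I_def)

context gtilde_levi_civita
begin

lemma box_mem: "p \<in> I \<longleftrightarrow> p $ 1 \<in> I1 \<and> p $ 2 \<in> I2 \<and> p $ 3 \<in> I3"
  by (simp add: I_def box3_def)

lemma box_nz: "p \<in> I \<Longrightarrow> f1 (p $ 2) \<noteq> 0" "p \<in> I \<Longrightarrow> f2 (p $ 3) \<noteq> 0"
  using f1_nz f2_nz by (simp_all add: box_mem)

lemma frame_nth:
  "E 1 p $ j = (if j = 1 then f1 (p $ 2) else 0)"
  "E 2 p $ j = (if j = 2 then f2 (p $ 3) else 0)"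
  "E 3 p $ j = (if j = 3 then 1 else 0)"
  by (simp_all add: E_def frame_def axis_def)

lemma h_smooth: "smooth_on I2 h"
  unfolding h_def
  by (intro smooth_on_divide smooth_on_deriv open_intervals f1_smooth f1_nz)

lemma d_smooth: "smooth_on I3 d"
  unfolding d_def
  by (intro smooth_on_divide smooth_on_deriv open_intervals f2_smooth f2_nz)

lemma frame_has_derivative:
  assumes "p \<in> I"
  shows "(E 1 has_derivative (\<lambda>v. (deriv f1 (p $ 2) * v $ 2) *\<^sub>R axis 1 1)) (at p)"
    and "(E 2 has_derivative (\<lambda>v. (deriv f2 (p $ 3) * v $ 3) *\<^sub>R axis 2 1)) (at p)"
    and "(E 3 has_derivative (\<lambda>v. 0)) (at p)"
proof -
  have "(f1 has_field_derivative deriv f1 (p $ 2)) (at (p $ 2))"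
    using assms f1_smooth by (simp add: smooth_on_DERIV box_mem)
  from has_derivative_scaleR_left[OF has_derivative_component[OF this]]
  show "(E 1 has_derivative (\<lambda>v. (deriv f1 (p $ 2) * v $ 2) *\<^sub>R axis 1 1)) (at p)"
    by (simp add: E_def frame_def[abs_def])
  have "(f2 has_field_derivative deriv f2 (p $ 3)) (at (p $ 3))"
    using assms f2_smooth by (simp add: smooth_on_DERIV box_mem)
  from has_derivative_scaleR_left[OF has_derivative_component[OF this]]
  show "(E 2 has_derivative (\<lambda>v. (deriv f2 (p $ 3) * v $ 3) *\<^sub>R axis 2 1)) (at p)"
    by (simp add: E_def frame_def[abs_def])
  show "(E 3 has_derivative (\<lambda>v. 0)) (at p)"
    by (simp add: E_def frame_def[abs_def])
qed

text \<open>The coefficient of \<open>E k\<close> in the bracket of \<open>E i\<close> and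
  \<open>E j\<close>: up to antisymmetry, the only nonzero brackets are
  \<open>[E 1, E 2] = - a E 1\<close> and \<open>[E 2, E 3] = - d E 2\<close>.\<close>

definition structure_fun :: "3 \<Rightarrow> 3 \<Rightarrow> 3 \<Rightarrow> real ^ 3 \<Rightarrow> real" where
  "structure_fun i j k p =
     (if (i, j, k) = (1, 2, 1) then - a p else if (i, j, k) = (2, 1, 1) then a p
      else if (i, j, k) = (2, 3, 2) then - d (p $ 3) else if (i, j, k) = (3, 2, 2) then d (p $ 3) else 0)"

lemma frechet_derivative_frame:
  assumes "p \<in> I"
  shows "frechet_derivative (E 1) (at p) = (\<lambda>v. (deriv f1 (p $ 2) * v $ 2) *\<^sub>R axis 1 1)"
    and "frechet_derivative (E 2) (at p) = (\<lambda>v. (deriv f2 (p $ 3) * v $ 3) *\<^sub>R axis 2 1)"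
    and "frechet_derivative (E 3) (at p) = (\<lambda>v. 0)"
  by (rule frame_has_derivative[OF assms, THEN frechet_derivative_at, symmetric])+

lemma lie_bracket_frame:
  assumes "p \<in> I"
  shows "g p (lie_bracket (E i) (E j) p) (E k p) = structure_fun i j k p"
proof -
  have a: "a p = f2 (p $ 3) * deriv f1 (p $ 2) / f1 (p $ 2)" and d: "d (p $ 3) = deriv f2 (p $ 3) / f2 (p $ 3)"
    by (simp_all add: a_def h_def d_def)
  \<comment> \<open>The indices are quantified inside the statement so that \<open>forall_3\<close>
    splits it into its 27 cases.\<close>
  have *: "\<forall>i j k. g p (lie_bracket (E i) (E j) p) (E k p) = structure_fun i j k p"
    unfolding forall_3 lie_bracket_def frechet_derivative_frame[OF assms] structure_fun_def a d
      g_def gtilde_def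
    using box_nz[OF assms] by (simp add: frame_nth axis_def power2_eq_square)
  then show ?thesis
    by blast
qed

text \<open>Koszul's formula with the brackets inserted: for instance \<open>conn 1 1 2\<close> is
  \<open>(0 + a + a) / 2\<close> and \<open>conn 2 2 3\<close> is
  \<open>(0 + d + d) / 2\<close>.\<close>

lemma conn_frame:
  assumes "p \<in> I"
  shows "conn i j k p =
     (if (i, j, k) = (1, 1, 2) then a p else if (i, j, k) = (1, 2, 1) then - a p
      else if (i, j, k) = (2, 2, 3) then d (p $ 3) else if (i, j, k) = (2, 3, 2) then - d (p $ 3) else 0)"
proof -
  have "\<forall>i j k. conn i j k p =
     (if (i, j, k) = (1, 1, 2) then a p else if (i, j, k) = (1, 2, 1) then - a p
      else if (i, j, k) = (2, 2, 3) then d (p $ 3) else if (i, j, k) = (2, 3, 2) then - d (p $ 3) else 0)"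
    unfolding forall_3 conn_koszul[OF assms] lie_bracket_frame[OF assms] structure_fun_def
    by simp
  then show ?thesis
    by blast
qed

lemma dir_deriv_a:
  assumes "p \<in> I"
  shows "dir_deriv X a p = f2 (p $ 3) * deriv h (p $ 2) * X p $ 2 + a p * d (p $ 3) * X p $ 3"
    and "dir_deriv X (\<lambda>q. - a q) p =
      - (f2 (p $ 3) * deriv h (p $ 2) * X p $ 2 + a p * d (p $ 3) * X p $ 3)"
proof -
  have "(f2 has_field_derivative deriv f2 (p $ 3)) (at (p $ 3))"
    "(h has_field_derivative deriv h (p $ 2)) (at (p $ 2))"
    using assms f2_smooth h_smooth by (simp_all add: smooth_on_DERIV box_mem)
  note D = has_derivative_mult[OF this[THEN has_derivative_component]]
  \<comment> \<open>Along the third coordinate only the factor \<open>f2\<close> of \<open>a\<close>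
    varies; writing its contribution \<open>f2' h\<close> as \<open>a d\<close> puts the result into
    the form used for the Ricci tensor.\<close>
  have ad: "deriv f2 (p $ 3) * h (p $ 2) = a p * d (p $ 3)"
    using box_nz[OF assms] by (simp add: a_def d_def)
  show "dir_deriv X a p = f2 (p $ 3) * deriv h (p $ 2) * X p $ 2 + a p * d (p $ 3) * X p $ 3"
    unfolding dir_deriv_has_derivative[OF D, folded a_def] ad[symmetric] by simp
  show "dir_deriv X (\<lambda>q. - a q) p =
      - (f2 (p $ 3) * deriv h (p $ 2) * X p $ 2 + a p * d (p $ 3) * X p $ 3)"
    using dir_deriv_has_derivative[OF has_derivative_minus[OF D], of X]
    unfolding ad[symmetric] by (simp add: a_def)
qed

lemma dir_deriv_d:
  assumes "p \<in> I"
  shows "dir_deriv X (\<lambda>q. d (q $ 3)) p = deriv d (p $ 3) * X p $ 3"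
    and "dir_deriv X (\<lambda>q. - d (q $ 3)) p = - (deriv d (p $ 3) * X p $ 3)"
proof -
  have "(d has_field_derivative deriv d (p $ 3)) (at (p $ 3))"
    using assms d_smooth by (simp add: smooth_on_DERIV box_mem)
  note D = has_derivative_component[OF this]
  show "dir_deriv X (\<lambda>q. d (q $ 3)) p = deriv d (p $ 3) * X p $ 3"
    by (rule dir_deriv_has_derivative[OF D])
  show "dir_deriv X (\<lambda>q. - d (q $ 3)) p = - (deriv d (p $ 3) * X p $ 3)"
    by (rule dir_deriv_has_derivative[OF has_derivative_minus[OF D]])
qed

text \<open>The case formula for \<open>conn\<close> holds on the open set \<open>I\<close>, which
  is enough to differentiate it. The cases depend on the indices alone, so the derivative passes
  into them.\<close>

lemma dir_deriv_conn:
  assumes "p \<in> I"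
  shows "dir_deriv X (conn i j k) p =
     (if (i, j, k) = (1, 1, 2) then dir_deriv X a p
      else if (i, j, k) = (1, 2, 1) then dir_deriv X (\<lambda>q. - a q) p
      else if (i, j, k) = (2, 2, 3) then dir_deriv X (\<lambda>q. d (q $ 3)) p
      else if (i, j, k) = (2, 3, 2) then dir_deriv X (\<lambda>q. - d (q $ 3)) p else 0)"
proof -
  have "dir_deriv X (conn i j k) p = dir_deriv X (\<lambda>q.
     if (i, j, k) = (1, 1, 2) then a q else if (i, j, k) = (1, 2, 1) then - a q
     else if (i, j, k) = (2, 2, 3) then d (q $ 3) else if (i, j, k) = (2, 3, 2) then - d (q $ 3) else 0) p"
    by (rule dir_deriv_cong_open[OF open_S assms]) (rule conn_frame)
  then show ?thesis
    using dir_deriv_locally_const[OF open_S assms, of "\<lambda>_. 0" 0 X] by auto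
qed

text \<open>The planes of \<open>E 1, E 2\<close> and of \<open>E 2, E 3\<close> have sectional
  curvatures \<open>f2^2 h' - a^2\<close> and \<open>d' - d^2\<close>, that of
  \<open>E 1, E 3\<close> has 0, and the diagonal entries are sums of these. The entry
  \<open>a d\<close> comes from the summand \<open>k = 1\<close> of the trace.\<close>

lemma ricci_frame:
  assumes "p \<in> I"
  shows "ricci g nabla E (E 1) (E 1) p = (f2 (p $ 3))\<^sup>2 * deriv h (p $ 2) - (a p)\<^sup>2"
    and "ricci g nabla E (E 2) (E 2) p =
      (f2 (p $ 3))\<^sup>2 * deriv h (p $ 2) - (a p)\<^sup>2 + deriv d (p $ 3) - (d (p $ 3))\<^sup>2"
    and "ricci g nabla E (E 3) (E 3) p = deriv d (p $ 3) - (d (p $ 3))\<^sup>2"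
    and "ricci g nabla E (E 1) (E 2) p = 0"
    and "ricci g nabla E (E 1) (E 3) p = 0"
    and "ricci g nabla E (E 2) (E 3) p = a p * d (p $ 3)"
  by (simp_all add: ricci_def curvature_frame[OF assms] sum_3 conn_frame[OF assms]
      dir_deriv_conn[OF assms] dir_deriv_a[OF assms] dir_deriv_d[OF assms] frame_nth
      power2_eq_square)

lemma lie_deriv_frame:
  assumes p: "p \<in> I" and V: "smooth_on I V"
    and V_eq: "\<And>q. q \<in> I \<Longrightarrow> V q = V1 (q $ 3) *\<^sub>R E 1 q + V2 (q $ 3) *\<^sub>R E 2 q + V3 (q $ 3) *\<^sub>R E 3 q"
    and smooth: "smooth_on I3 V1" "smooth_on I3 V2" "smooth_on I3 V3"
  shows "lie_deriv_metric V g (E 1) (E 1) p = - 2 * a p * V2 (p $ 3)"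
    and "lie_deriv_metric V g (E 2) (E 2) p = - 2 * d (p $ 3) * V3 (p $ 3)"
    and "lie_deriv_metric V g (E 3) (E 3) p = 2 * deriv V3 (p $ 3)"
    and "lie_deriv_metric V g (E 1) (E 2) p = a p * V1 (p $ 3)"
    and "lie_deriv_metric V g (E 1) (E 3) p = deriv V1 (p $ 3)"
    and "lie_deriv_metric V g (E 2) (E 3) p = deriv V2 (p $ 3) + d (p $ 3) * V2 (p $ 3)"
proof -
  \<comment> \<open>By orthonormality the scalar products with the frame recover \<open>V1\<close>,
    \<open>V2\<close>, \<open>V3\<close>. These vary with the third coordinate only, so just
    \<open>E 3\<close> differentiates them.\<close>
  have comp: "g q (V q) (E 1 q) = V1 (q $ 3)" "g q (V q) (E 2 q) = V2 (q $ 3)"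
    "g q (V q) (E 3 q) = V3 (q $ 3)" if "q \<in> I" for q
    using box_nz[OF that]
    by (simp_all add: V_eq[OF that] g_def gtilde_def frame_nth power2_eq_square)
  have deriv: "dir_deriv (E i) (\<lambda>q. f (q $ 3)) p = deriv f (p $ 3) * E i p $ 3" if "smooth_on I3 f" for f i
    using that p by (intro dir_deriv_has_derivative has_derivative_component smooth_on_DERIV) (auto simp: box_mem)
  have dcomp: "dir_deriv (E i) (\<lambda>q. g q (V q) (E 1 q)) p = deriv V1 (p $ 3) * E i p $ 3"
    "dir_deriv (E i) (\<lambda>q. g q (V q) (E 2 q)) p = deriv V2 (p $ 3) * E i p $ 3"
    "dir_deriv (E i) (\<lambda>q. g q (V q) (E 3 q)) p = deriv V3 (p $ 3) * E i p $ 3" for i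
    unfolding deriv[OF smooth(1), symmetric] deriv[OF smooth(2), symmetric] deriv[OF smooth(3), symmetric]
    by (rule dir_deriv_cong_open[OF open_S p]; simp add: comp)+
  show "lie_deriv_metric V g (E 1) (E 1) p = - 2 * a p * V2 (p $ 3)"
    "lie_deriv_metric V g (E 2) (E 2) p = - 2 * d (p $ 3) * V3 (p $ 3)"
    "lie_deriv_metric V g (E 3) (E 3) p = 2 * deriv V3 (p $ 3)"
    "lie_deriv_metric V g (E 1) (E 2) p = a p * V1 (p $ 3)"
    "lie_deriv_metric V g (E 1) (E 3) p = deriv V1 (p $ 3)"
    "lie_deriv_metric V g (E 2) (E 3) p = deriv V2 (p $ 3) + d (p $ 3) * V2 (p $ 3)"
    by (simp_all add: lie_deriv_metric_frame[OF p V] sum_3 conn_frame[OF p] dcomp comp[OF p] frame_nth)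
qed

lemma soliton_equations:
  assumes p: "p \<in> I"
    and V_eq: "\<And>q. q \<in> I \<Longrightarrow> V q = V1 (q $ 3) *\<^sub>R E 1 q + V2 (q $ 3) *\<^sub>R E 2 q + V3 (q $ 3) *\<^sub>R E 3 q"
    and smooth: "smooth_on I3 V1" "smooth_on I3 V2" "smooth_on I3 V3"
    and soliton: "almost_eta_ricci_soliton_on I g nabla E V (dx 3) lam mu"
  shows "lam p = a p * V2 (p $ 3) - (f2 (p $ 3))\<^sup>2 * deriv h (p $ 2) + (a p)\<^sup>2"
    and "d (p $ 3) * V3 (p $ 3) = a p * V2 (p $ 3) + deriv d (p $ 3) - (d (p $ 3))\<^sup>2"
    and "deriv V3 (p $ 3) = - (deriv d (p $ 3) - (d (p $ 3))\<^sup>2) - (lam p + mu p)"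
    and "a p * V1 (p $ 3) = 0"
    and "deriv V1 (p $ 3) = 0"
    and "deriv V2 (p $ 3) + d (p $ 3) * V2 (p $ 3) + 2 * (a p * d (p $ 3)) = 0"
proof -
  have V: "smooth_on I V"
    using soliton by (simp add: almost_eta_ricci_soliton_on_def)
  \<comment> \<open>On frame fields the metric is the Kronecker delta and \<open>dx 3\<close> sees
    only \<open>E 3\<close>, so \<open>mu\<close> enters the (3,3) equation alone.\<close>
  have eq: "lie_deriv_metric V g (E i) (E j) p / 2 + ricci g nabla E (E i) (E j) p
      + lam p * (if i = j then 1 else 0) + mu p * (E i p $ 3 * E j p $ 3) = 0" for i j
  proof -
    have "1 / 2 * lie_deriv_metric V g (E i) (E j) p + ricci g nabla E (E i) (E j) p
        + lam p * g p (E i p) (E j p) + mu p * (dx 3 p (E i p) * dx 3 p (E j p)) = 0"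
      using soliton frame_smooth p unfolding almost_eta_ricci_soliton_on_def by blast
    then show ?thesis
      by (simp add: dx_def frame_orthonormal[OF p])
  qed
  note E_eq = ricci_frame[OF p] lie_deriv_frame[OF p V V_eq smooth] frame_nth
  show "lam p = a p * V2 (p $ 3) - (f2 (p $ 3))\<^sup>2 * deriv h (p $ 2) + (a p)\<^sup>2"
    using eq[of 1 1] by (simp add: E_eq)
  \<comment> \<open>Inserting \<open>lam\<close> from the (1,1) equation into the (2,2) equation
    cancels \<open>f2^2 h' - a^2\<close>.\<close>
  then show "d (p $ 3) * V3 (p $ 3) = a p * V2 (p $ 3) + deriv d (p $ 3) - (d (p $ 3))\<^sup>2"
    using eq[of 2 2] by (simp add: E_eq)
  show "deriv V3 (p $ 3) = - (deriv d (p $ 3) - (d (p $ 3))\<^sup>2) - (lam p + mu p)"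
    using eq[of 3 3] by (simp add: E_eq)
  show "a p * V1 (p $ 3) = 0"
    using eq[of 1 2] by (simp add: E_eq)
  show "deriv V1 (p $ 3) = 0"
    using eq[of 1 3] by (simp add: E_eq)
  show "deriv V2 (p $ 3) + d (p $ 3) * V2 (p $ 3) + 2 * (a p * d (p $ 3)) = 0"
    using eq[of 2 3] by (simp add: E_eq) (simp add: field_simps)
qed

end

section \<open>Separation of variables\<close>

lemma is_interval_DERIV_zero_const:
  fixes f :: "real \<Rightarrow> real"
  assumes "is_interval T" "\<And>t. t \<in> T \<Longrightarrow> (f has_field_derivative 0) (at t)"
  shows "\<exists>c. \<forall>t\<in>T. f t = c"
  using has_field_derivative_zero_constant[of T f] assms
  by (auto simp: is_interval_convex_1 intro: has_field_derivative_at_within)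

lemma constant_on_open_deriv:
  fixes f :: "real \<Rightarrow> real"
  assumes "open T" "t \<in> T" "f constant_on T"
  shows "deriv f t = 0"
proof -
  obtain c where "\<And>t. t \<in> T \<Longrightarrow> f t = c"
    using assms(3) by (auto simp: constant_on_def)
  then have "(f has_field_derivative 0) (at t)"
    using has_field_derivative_transform_within_open[OF DERIV_const assms(1,2)] by metis
  then show ?thesis
    by (rule DERIV_imp_deriv)
qed

text \<open>The product of \<open>f\<close> with \<open>exp (- c y)\<close> has derivative 0, so it
  is a constant \<open>C\<close> on the interval; its value at \<open>y0\<close> shows that
  \<open>C\<close> is nonzero.\<close>

lemma log_derivative_const_imp_exp:
  fixes f :: "real \<Rightarrow> real"
  assumes "is_interval T" "y0 \<in> T"
    and "\<And>y. y \<in> T \<Longrightarrow> (f has_field_derivative f' y) (at y)" "\<And>y. y \<in> T \<Longrightarrow> f y \<noteq> 0"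
    and "\<And>y. y \<in> T \<Longrightarrow> f' y / f y = c"
  obtains C where "C \<noteq> 0" "\<And>y. y \<in> T \<Longrightarrow> f y = C * exp (c * y)"
proof -
  have "((\<lambda>y. f y * exp (- c * y)) has_field_derivative 0) (at y)" if "y \<in> T" for y
  proof -
    have "f' y = c * f y"
      using assms(4,5)[OF that] by (auto simp: divide_eq_eq)
    then show ?thesis
      by (auto intro!: derivative_eq_intros assms(3)[OF that])
  qed
  from is_interval_DERIV_zero_const[OF assms(1) this]
  obtain C where C: "\<And>y. y \<in> T \<Longrightarrow> f y * exp (- c * y) = C"
    by blast
  show thesis
  proof
    show "C \<noteq> 0"
      using C[OF assms(2)] assms(4)[OF assms(2)] by auto
    show "f y = C * exp (c * y)" if "y \<in> T" for y
      unfolding C[OF that, symmetric] by (simp add: mult.assoc mult_exp_exp)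
  qed
qed

text \<open>The equation says \<open>(V f)' = - 2 (h y) f f'\<close> for every \<open>y\<close>, so a single \<open>t\<close> with
  \<open>f' t \<noteq> 0\<close> forces \<open>h\<close> to be constant.\<close>

lemma separation_of_variables:
  fixes f V h :: "real \<Rightarrow> real"
  assumes T: "open T" "is_interval T" and y0: "y0 \<in> J"
    and f: "smooth_on T f" "\<And>t. t \<in> T \<Longrightarrow> f t \<noteq> 0" and V: "smooth_on T V"
    and eq: "\<And>y t. y \<in> J \<Longrightarrow> t \<in> T \<Longrightarrow>
      deriv V t + deriv f t / f t * V t + 2 * (f t * h y * (deriv f t / f t)) = 0"
  shows "f constant_on T \<Longrightarrow> V constant_on T"
    and "\<not> f constant_on T \<Longrightarrow>
      (\<forall>y\<in>J. h y = h y0) \<and> (\<exists>c. \<forall>t\<in>T. V t = - h y0 * f t + c / f t)"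
proof -
  have eq': "deriv V t * f t + deriv f t * V t + 2 * h y * f t * deriv f t = 0"
    if "y \<in> J" "t \<in> T" for y t
    using eq[OF that] f(2)[OF that(2)] by (simp add: field_simps)
  note D = smooth_on_DERIV[OF f(1)] smooth_on_DERIV[OF V]
  {
    assume const: "f constant_on T"
    have "(V has_field_derivative 0) (at t)" if "t \<in> T" for t
      using D(2)[OF that] eq'[OF y0 that] f(2)[OF that] constant_on_open_deriv[OF T(1) that const] by simp
    then show "V constant_on T"
      using is_interval_DERIV_zero_const[OF T(2)] by (auto simp: constant_on_def)
  }
  {
    assume nonconst: "\<not> f constant_on T"
    obtain t0 where t0: "t0 \<in> T" "deriv f t0 \<noteq> 0"
      using nonconst is_interval_DERIV_zero_const[OF T(2), of f] D(1) by (metis constant_on_def)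
    have h: "h y = h y0" if "y \<in> J" for y
    proof -
      have "2 * h y * (f t0 * deriv f t0) = 2 * h y0 * (f t0 * deriv f t0)"
        using eq'[OF that t0(1)] eq'[OF y0 t0(1)] by linarith
      then show ?thesis
        using t0 f(2) by simp
    qed
    \<comment> \<open>A first integral of the equation; dividing its constant value \<open>c\<close>
      by \<open>f t\<close> yields the formula for \<open>V\<close>.\<close>
    have "((\<lambda>t. V t * f t + h y0 * (f t * f t)) has_field_derivative 0) (at t)" if "t \<in> T" for t
      by (rule derivative_eq_intros D that refl)+
        (use eq'[OF y0 that] in \<open>simp add: algebra_simps\<close>)
    from is_interval_DERIV_zero_const[OF T(2) this]
    obtain c where c: "\<And>t. t \<in> T \<Longrightarrow> V t * f t + h y0 * (f t * f t) = c"
      by blast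
    have "V t = - h y0 * f t + c / f t" if "t \<in> T" for t
      using f(2)[OF that] unfolding c[OF that, symmetric] by (simp add: field_simps)
    with h show "(\<forall>y\<in>J. h y = h y0) \<and> (\<exists>c. \<forall>t\<in>T. V t = - h y0 * f t + c / f t)"
      by blast
  }
qed

section \<open>From the six scalar equations to the constants and \<open>F\<close>\<close>

theorem theorem3p21:
  fixes I1 I2 I3 :: "real set"
    and f1 f2 V1 V2 V3 :: "real \<Rightarrow> real"
    and nabla :: "3 connection"
    and V :: "3 vfield"
    and lam mu :: "real ^ 3 \<Rightarrow> real"
    and I :: "(real ^ 3) set" and g :: "3 metric" and E :: "3 \<Rightarrow> 3 vfield"
    and a :: "real ^ 3 \<Rightarrow> real" and d :: "real \<Rightarrow> real"
  assumes "open I1" "is_interval I1" "open I2" "is_interval I2" "open I3" "is_interval I3"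
    and I: "I = box3 I1 I2 I3"
    and "smooth_on I (\<lambda>p. f1 (p $ 2))" "\<forall>p\<in>I. f1 (p $ 2) \<noteq> 0"
    and "smooth_on I (\<lambda>p. f2 (p $ 3))" "\<forall>p\<in>I. f2 (p $ 3) \<noteq> 0"
    and g: "g = gtilde (\<lambda>p. f1 (p $ 2)) (\<lambda>p. f2 (p $ 3))"
    and E: "E = frame (\<lambda>p. f1 (p $ 2)) (\<lambda>p. f2 (p $ 3))"
    and V: "\<forall>p\<in>I. V p = V1 (p $ 3) *\<^sub>R E 1 p + V2 (p $ 3) *\<^sub>R E 2 p + V3 (p $ 3) *\<^sub>R E 3 p"
    and soliton: "almost_eta_ricci_soliton_on I g nabla E V (dx 3) lam mu"
    and a: "a = (\<lambda>p. f2 (p $ 3) * (deriv f1 (p $ 2) / f1 (p $ 2)))"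
    and d: "d = (\<lambda>t. deriv f2 t / f2 t)"
  shows "\<exists>c1 c2 c3 :: real. \<exists>F :: real \<Rightarrow> real. smooth_on I2 F \<and>
    (\<forall>p\<in>I.
       V1 (p $ 3) = c1 \<and>
       V2 (p $ 3) = c2 * f2 (p $ 3) + c3 / f2 (p $ 3) \<and>
       a p * V1 (p $ 3) = 0 \<and>
       d (p $ 3) * V3 (p $ 3) = a p * V2 (p $ 3) + deriv d (p $ 3) - (d (p $ 3))\<^sup>2 \<and>
       a p = - c2 * f2 (p $ 3) + F (p $ 2) \<and>
       lam p = a p * V2 (p $ 3) - f2 (p $ 3) * deriv F (p $ 2) + (a p)\<^sup>2 \<and>
       deriv V3 (p $ 3) = - (deriv d (p $ 3) - (d (p $ 3))\<^sup>2) - (lam p + mu p)) \<and>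
    (f2 constant_on I3 \<longrightarrow> V2 constant_on I3) \<and>
    (\<not> f2 constant_on I3 \<longrightarrow>
       (\<exists>c4. c4 \<noteq> 0 \<and> (\<forall>y\<in>I2. f1 y = c4 * exp (- c2 * y))) \<and>
       (\<forall>p\<in>I. a p = - c2 * f2 (p $ 3))) \<and>
    ((\<exists>t\<in>I3. V1 t \<noteq> 0) \<longrightarrow>
       (\<forall>p\<in>I. a p = 0 \<and>
               d (p $ 3) * V3 (p $ 3) = deriv d (p $ 3) - (d (p $ 3))\<^sup>2 \<and>
               lam p = - f2 (p $ 3) * deriv F (p $ 2)) \<and>
       f1 constant_on I2 \<and>
       (\<not> f2 constant_on I3 \<longrightarrow>
          (\<forall>p\<in>I. V2 (p $ 3) = c3 / f2 (p $ 3) \<and>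
                  F (p $ 2) = 0 \<and>
                  lam p = 0 \<and>
                  mu p = - deriv V3 (p $ 3) - (deriv d (p $ 3) - (d (p $ 3))\<^sup>2))))"
proof -
  have sol: "riemannian_metric_on I g" "levi_civita_on I g nabla" "orthonormal_frame_on I g E" "smooth_on I V"
    and "\<exists>p\<in>I. mu p \<noteq> 0"
    using soliton by (simp_all add: almost_eta_ricci_soliton_on_def)
  \<comment> \<open>Since \<open>mu\<close> is not identically zero, \<open>I\<close> has a point;
    the coordinate slices are taken through it.\<close>
  then obtain p0 where p0: "p0 \<in> I"
    by blast
  have open_I: "open I"
    using assms(1,3,5) by (simp add: I open_box3)
  note slice = smooth_on_box3_slice[OF assms(3,5) p0[unfolded I], folded I]
  have y0: "p0 $ 2 \<in> I2" and t0: "p0 $ 3 \<in> I3"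
    using p0 by (simp_all add: I box3_def)
  \<comment> \<open>The second and third coordinates range independently over \<open>I2\<close> and
    \<open>I3\<close>, so equations at points of \<open>I\<close> become equations for all pairs
    \<open>y\<close>, \<open>t\<close>.\<close>
  have mem: "\<exists>p\<in>I. p $ 2 = y \<and> p $ 3 = t" if "y \<in> I2" "t \<in> I3" for y t
    using p0 that by (intro bexI[of _ "vector [p0 $ 1, y, t]"]) (simp_all add: I box3_def vector_3)
  have f1_nz: "f1 y \<noteq> 0" if "y \<in> I2" for y
    using mem[OF that t0] assms(9) by blast
  have f2_nz: "f2 t \<noteq> 0" if "t \<in> I3" for t
    using mem[OF y0 that] assms(11) by blast
  define h where "h = (\<lambda>y. deriv f1 y / f1 y)"
  have a_eq: "a = (\<lambda>p. f2 (p $ 3) * h (p $ 2))"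
    by (simp add: a h_def)
  interpret gtilde_levi_civita I1 I2 I3 f1 f2 nabla I g E h d a
    by unfold_locales (use assms(1,3,5) sol slice assms(8,10) f1_nz f2_nz in
        \<open>simp_all add: I g E a_eq d h_def\<close>)
  \<comment> \<open>The soliton gives smoothness of the field \<open>V\<close>; dividing its
    coordinates by the frame factors transfers this to \<open>V1\<close>, \<open>V2\<close>,
    \<open>V3\<close>, first on \<open>I\<close> and then on the slice \<open>I3\<close>.\<close>
  have V_nth: "V p $ 1 / f1 (p $ 2) = V1 (p $ 3)" "V p $ 2 / f2 (p $ 3) = V2 (p $ 3)"
    "V p $ 3 = V3 (p $ 3)" if "p \<in> I" for p
    using V that box_nz[OF that] by (simp_all add: frame_nth)
  note V_smooth = smooth_on_nth[OF open_I sol(4)]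
  have "smooth_on I (\<lambda>p. V1 (p $ 3))"
    by (rule smooth_on_cong[OF open_I V_nth(1) smooth_on_divide[OF open_I V_smooth assms(8) box_nz(1)]])
  moreover have "smooth_on I (\<lambda>p. V2 (p $ 3))"
    by (rule smooth_on_cong[OF open_I V_nth(2) smooth_on_divide[OF open_I V_smooth assms(10) box_nz(2)]])
  moreover have "smooth_on I (\<lambda>p. V3 (p $ 3))"
    by (rule smooth_on_cong[OF open_I V_nth(3) V_smooth])
  ultimately have smooth: "smooth_on I3 V1" "smooth_on I3 V2" "smooth_on I3 V3"
    by (blast intro: slice(2))+
  note eqs = soliton_equations[OF _ V[rule_format] smooth soliton]
  have V1_deriv: "deriv V1 t = 0" if "t \<in> I3" for t
    using mem[OF y0 that] eqs(5) by blast
  have "(V1 has_field_derivative 0) (at t)" if "t \<in> I3" for t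
    using smooth_on_DERIV[OF smooth(1) that] V1_deriv[OF that] by simp
  from is_interval_DERIV_zero_const[OF assms(6) this]
  obtain c1 where c1: "\<And>t. t \<in> I3 \<Longrightarrow> V1 t = c1"
    by blast
  have h_zero: "h y = 0" if nz: "c1 \<noteq> 0" and y: "y \<in> I2" for y
  proof -
    obtain p where p: "p \<in> I" "p $ 2 = y" "p $ 3 = p0 $ 3"
      using mem[OF y t0] by blast
    then have "f2 (p0 $ 3) * h y * c1 = 0"
      using eqs(4)[OF p(1)] c1[OF t0] by (simp add: a_eq)
    then show ?thesis
      using nz f2_nz[OF t0] by simp
  qed
  have V2_eq: "deriv V2 t + deriv f2 t / f2 t * V2 t + 2 * (f2 t * h y * (deriv f2 t / f2 t)) = 0"
    if yt: "y \<in> I2" "t \<in> I3" for y t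
  proof -
    obtain p where p: "p \<in> I" "p $ 2 = y" "p $ 3 = t"
      using mem[OF yt] by blast
    then show ?thesis
      using eqs(6)[OF p(1)] by (simp add: a_eq d)
  qed
  have V2_const: "V2 constant_on I3" if "f2 constant_on I3"
    by (rule separation_of_variables(1)[OF assms(5,6) y0 f2_smooth _ smooth(2) _ that])
      (rule f2_nz V2_eq; assumption)+
  have separated: "(\<forall>y\<in>I2. h y = h (p0 $ 2)) \<and> (\<exists>c. \<forall>t\<in>I3. V2 t = - h (p0 $ 2) * f2 t + c / f2 t)"
    if "\<not> f2 constant_on I3"
    by (rule separation_of_variables(2)[OF assms(5,6) y0 f2_smooth _ smooth(2) _ that])
      (rule f2_nz V2_eq; assumption)+
  \<comment> \<open>One choice of constants and \<open>F\<close> has to serve all the claims. The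
    relation between the derivatives of \<open>F\<close> and \<open>h\<close> converts the formula
    for \<open>lam\<close>, and the last clause is what (ii) and the end of (iii) use.\<close>
  have F_ex: "\<exists>c2 c3 F. smooth_on I2 F \<and> (\<forall>t\<in>I3. V2 t = c2 * f2 t + c3 / f2 t) \<and>
    (\<forall>y\<in>I2. \<forall>t\<in>I3. f2 t * h y = - c2 * f2 t + F y \<and> f2 t * deriv F y = (f2 t)\<^sup>2 * deriv h y) \<and>
    (\<not> f2 constant_on I3 \<longrightarrow> (\<forall>y\<in>I2. F y = 0 \<and> deriv F y = 0 \<and> h y = - c2))"
  proof (cases "f2 constant_on I3")
    case True
    then obtain k C where k: "\<And>t. t \<in> I3 \<Longrightarrow> f2 t = k" and C: "\<And>t. t \<in> I3 \<Longrightarrow> V2 t = C"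
      using V2_const[OF True] unfolding constant_on_def by blast
    have "deriv (\<lambda>y. k * h y) y = k * deriv h y" if "y \<in> I2" for y
      using smooth_on_DERIV[OF h_smooth that] by (intro DERIV_imp_deriv DERIV_cmult)
    moreover have "smooth_on I2 (\<lambda>y. k * h y)"
      by (rule smooth_on_mult[OF assms(3) smooth_on_const h_smooth])
    moreover have "k \<noteq> 0"
      using k[OF t0] f2_nz[OF t0] by simp
    \<comment> \<open>With \<open>f2 = k\<close> and \<open>V2 = C\<close>, the choice
      \<open>c3 = C * k\<close> gives \<open>c3 / f2 = C\<close>, while \<open>F = k h\<close> is
      all of \<open>a\<close>.\<close>
    ultimately show ?thesis
      using True k C
      by (intro exI[of _ 0] exI[of _ "C * k"] exI[of _ "\<lambda>y. k * h y"]) (simp add: power2_eq_square)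
  next
    case False
    obtain c where h: "\<And>y. y \<in> I2 \<Longrightarrow> h y = h (p0 $ 2)"
      and c: "\<And>t. t \<in> I3 \<Longrightarrow> V2 t = - h (p0 $ 2) * f2 t + c / f2 t"
      using separated[OF False] by blast
    have "deriv h y = 0" if "y \<in> I2" for y
      using constant_on_open_deriv[OF assms(3) that] h by (metis constant_on_def)
    \<comment> \<open>Here \<open>h\<close> is constant, so \<open>a = h f2\<close> is already
      \<open>- c2 f2\<close> and \<open>F\<close> is 0; \<open>c3\<close> is the integration
      constant \<open>c\<close>.\<close>
    then show ?thesis
      using h c
      by (intro exI[of _ "- h (p0 $ 2)"] exI[of _ c] exI[of _ "\<lambda>_. 0"]) (simp add: smooth_on_const)
  qed
  then obtain c2 c3 F where F_smooth: "smooth_on I2 F"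
    and V2: "\<And>t. t \<in> I3 \<Longrightarrow> V2 t = c2 * f2 t + c3 / f2 t"
    and F: "\<And>y t. y \<in> I2 \<Longrightarrow> t \<in> I3 \<Longrightarrow> f2 t * h y = - c2 * f2 t + F y"
    and F': "\<And>y t. y \<in> I2 \<Longrightarrow> t \<in> I3 \<Longrightarrow> f2 t * deriv F y = (f2 t)\<^sup>2 * deriv h y"
    and nonconst: "\<And>y. \<not> f2 constant_on I3 \<Longrightarrow> y \<in> I2 \<Longrightarrow> F y = 0 \<and> deriv F y = 0 \<and> h y = - c2"
    by blast
  have lam: "lam p = a p * V2 (p $ 3) - f2 (p $ 3) * deriv F (p $ 2) + (a p)\<^sup>2" if "p \<in> I" for p
    using eqs(1)[OF that] F'[of "p $ 2" "p $ 3"] that by (simp add: box_mem)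
  have general: "V1 (p $ 3) = c1 \<and> V2 (p $ 3) = c2 * f2 (p $ 3) + c3 / f2 (p $ 3) \<and>
      a p * V1 (p $ 3) = 0 \<and>
      d (p $ 3) * V3 (p $ 3) = a p * V2 (p $ 3) + deriv d (p $ 3) - (d (p $ 3))\<^sup>2 \<and>
      a p = - c2 * f2 (p $ 3) + F (p $ 2) \<and>
      lam p = a p * V2 (p $ 3) - f2 (p $ 3) * deriv F (p $ 2) + (a p)\<^sup>2 \<and>
      deriv V3 (p $ 3) = - (deriv d (p $ 3) - (d (p $ 3))\<^sup>2) - (lam p + mu p)" if "p \<in> I" for p
  proof -
    have p: "p $ 2 \<in> I2" "p $ 3 \<in> I3"
      using that by (simp_all add: box_mem)
    then have "a p = - c2 * f2 (p $ 3) + F (p $ 2)"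
      using F by (simp add: a_eq)
    then show ?thesis
      by (intro conjI c1 V2 p eqs lam that)
  qed
  have exp: "(\<exists>c4. c4 \<noteq> 0 \<and> (\<forall>y\<in>I2. f1 y = c4 * exp (- c2 * y))) \<and> (\<forall>p\<in>I. a p = - c2 * f2 (p $ 3))"
    if "\<not> f2 constant_on I3"
  proof
    show "\<exists>c4. c4 \<noteq> 0 \<and> (\<forall>y\<in>I2. f1 y = c4 * exp (- c2 * y))"
      \<comment> \<open>The logarithmic derivative of \<open>f1\<close> is \<open>h\<close>, which
        equals \<open>- c2\<close> for nonconstant \<open>f2\<close>.\<close>
      using log_derivative_const_imp_exp[OF assms(4) y0 smooth_on_DERIV[OF f1_smooth] f1_nz, of "- c2"]
        nonconst[OF that] unfolding h_def by metis
    show "\<forall>p\<in>I. a p = - c2 * f2 (p $ 3)"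
      using nonconst[OF that] by (simp add: a_eq box_mem)
  qed
  have c1_nz: "(\<forall>p\<in>I. a p = 0 \<and> d (p $ 3) * V3 (p $ 3) = deriv d (p $ 3) - (d (p $ 3))\<^sup>2 \<and>
        lam p = - f2 (p $ 3) * deriv F (p $ 2)) \<and>
      f1 constant_on I2 \<and>
      (\<not> f2 constant_on I3 \<longrightarrow>
        (\<forall>p\<in>I. V2 (p $ 3) = c3 / f2 (p $ 3) \<and> F (p $ 2) = 0 \<and> lam p = 0 \<and>
          mu p = - deriv V3 (p $ 3) - (deriv d (p $ 3) - (d (p $ 3))\<^sup>2)))"
    if "\<exists>t\<in>I3. V1 t \<noteq> 0"
  proof -
    have h: "h y = 0" if "y \<in> I2" for y
      using h_zero that c1 \<open>\<exists>t\<in>I3. V1 t \<noteq> 0\<close> by metis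
    then have a_zero: "a p = 0" if "p \<in> I" for p
      using that by (simp add: a_eq box_mem)
    have "(f1 has_field_derivative 0) (at y)" if "y \<in> I2" for y
      using smooth_on_DERIV[OF f1_smooth that] h[OF that] f1_nz[OF that] by (simp add: h_def)
    then have "f1 constant_on I2"
      using is_interval_DERIV_zero_const[OF assms(4)] by (auto simp: constant_on_def)
    moreover have "V2 (p $ 3) = c3 / f2 (p $ 3) \<and> F (p $ 2) = 0 \<and> lam p = 0 \<and>
        mu p = - deriv V3 (p $ 3) - (deriv d (p $ 3) - (d (p $ 3))\<^sup>2)"
      if "\<not> f2 constant_on I3" "p \<in> I" for p
    proof -
      have p: "p $ 2 \<in> I2" "p $ 3 \<in> I3"
        using that(2) by (simp_all add: box_mem)
      \<comment> \<open>A nonzero \<open>V1\<close> forces \<open>h = 0\<close>, a nonconstant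
        \<open>f2\<close> forces \<open>h = - c2\<close>; together they remove the \<open>c2\<close>
        term from \<open>V2\<close>.\<close>
      have "c2 = 0" "F (p $ 2) = 0" "deriv F (p $ 2) = 0"
        using nonconst[OF that(1) p(1)] h[OF p(1)] by simp_all
      then show ?thesis
        using V2[OF p(2)] lam[OF that(2)] eqs(3)[OF that(2)] a_zero[OF that(2)] by simp
    qed
    moreover have "d (p $ 3) * V3 (p $ 3) = deriv d (p $ 3) - (d (p $ 3))\<^sup>2 \<and>
        lam p = - f2 (p $ 3) * deriv F (p $ 2)" if "p \<in> I" for p
      using eqs(2)[OF that] lam[OF that] a_zero[OF that] by simp
    ultimately show ?thesis
      using a_zero by blast
  qed
  show ?thesis
    by (rule exI[of _ c1], rule exI[of _ c2], rule exI[of _ c3], rule exI[of _ F],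
        rule conjI[OF F_smooth conjI[OF ballI[OF general] conjI[OF impI[OF V2_const]
          conjI[OF impI[OF exp] impI[OF c1_nz]]]]])
qed

end
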